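(* For all $x,y\in\mathbf R^d$ and all $s\in\mathbf R$, $$\langle x+y\rangle^s\leq\left(\frac{2}{\sqrt3}\right)^{|s|}\langle x\rangle^s\langle y\rangle^{|s|},$$ and the constant is optimal, i.e. for each $s\in\mathbf R$ the constant $(2/\sqrt3)^{|s|}$ cannot be replaced by a smaller one if the inequality is to hold for all $x,y\in\mathbf R^d$.
   Context: $\langle x\rangle=(1+|x|^2)^{1/2}$ for $x\in\mathbf R^d$, where $|\cdot|$ is the Euclidean norm and $d\geq1$. *)

theory Defs
  imports "HOL-Analysis.Analysis"
begin

definition jbracket :: "real ^ 'd \<Rightarrow> real" ("\<langle>_\<rangle>") where
  "\<langle>x\<rangle> = sqrt (1 + (norm x)\<^sup>2)"

end

theory Submission
  imports Defs
begin

text \<open>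
  For \<open>s = 1\<close>, with \<open>a = |x|\<close> and \<open>b = |y|\<close>, squaring reduces the inequality to
  \<open>4 (1 + a\<^sup>2) (1 + b\<^sup>2) - 3 (1 + (a + b)\<^sup>2) = (a - b)\<^sup>2 + (2 a b - 1)\<^sup>2 \<ge> 0\<close>,
  with equality for \<open>x = y\<close>, \<open>|x|\<^sup>2 = 1/2\<close>. Powers give the case \<open>s \<ge> 0\<close>; the case \<open>s < 0\<close>
  (and its extremal pair) comes from replacing \<open>(x, y)\<close> by \<open>(x + y, - y)\<close>.
\<close>

lemma jbracket_pos: "0 < \<langle>x\<rangle>"
  unfolding jbracket_def by (simp add: add_pos_nonneg)

lemma jbracket_minus: "\<langle>- x\<rangle> = \<langle>x\<rangle>"
  by (simp add: jbracket_def)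

lemma jbracket_add_le: "\<langle>x + y\<rangle> \<le> 2 / sqrt 3 * \<langle>x\<rangle> * \<langle>y\<rangle>"
proof -
  define a b where "a = norm x" and "b = norm y"
  \<comment> \<open>The triangle inequality passes to the worst case of vectors with the same
    direction, where only the two norms matter.\<close>
  have "3 * (1 + (norm (x + y))\<^sup>2) \<le> 3 * (1 + (a + b)\<^sup>2)"
    unfolding a_def b_def by (simp add: norm_triangle_ineq power_mono)
  also have "\<dots> \<le> 3 * (1 + (a + b)\<^sup>2) + (a - b)\<^sup>2 + (2 * a * b - 1)\<^sup>2"
    by simp
  also have "\<dots> = 4 * ((1 + a\<^sup>2) * (1 + b\<^sup>2))"
    by (simp add: power2_eq_square algebra_simps)
  finally have "sqrt (1 + (norm (x + y))\<^sup>2) \<le> sqrt (4 / 3 * ((1 + a\<^sup>2) * (1 + b\<^sup>2)))"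
    by simp
  then show ?thesis
    by (simp add: jbracket_def a_def b_def real_sqrt_mult real_sqrt_divide mult.assoc)
qed

lemma jbracket_add_powr_le:
  "\<langle>x + y\<rangle> powr s \<le> (2 / sqrt 3) powr \<bar>s\<bar> * \<langle>x\<rangle> powr s * \<langle>y\<rangle> powr \<bar>s\<bar>"
proof -
  \<comment> \<open>The exponent \<open>\<bar>s\<bar>\<close> is nonnegative, so raising to it is
    monotone. The vectors are kept general because negative \<open>s\<close> needs a pair other than
    \<open>x\<close>, \<open>y\<close>.\<close>
  have powr_le: "\<langle>v + w\<rangle> powr \<bar>s\<bar> \<le> (2 / sqrt 3) powr \<bar>s\<bar> * \<langle>v\<rangle> powr \<bar>s\<bar> * \<langle>w\<rangle> powr \<bar>s\<bar>"
    for v w :: "real ^ 'a"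
  proof -
    have "\<langle>v + w\<rangle> powr \<bar>s\<bar> \<le> (2 / sqrt 3 * \<langle>v\<rangle> * \<langle>w\<rangle>) powr \<bar>s\<bar>"
      by (intro powr_mono2 jbracket_add_le less_imp_le[OF jbracket_pos]) simp
    then show ?thesis
      by (simp add: powr_mult jbracket_pos less_imp_le
          del: times_divide_eq_left times_divide_eq_right)
  qed
  show ?thesis
  proof (cases "s \<ge> 0")
    case True
    then show ?thesis using powr_le[of x y] by simp
  next
    case False
    then have s: "s = - \<bar>s\<bar>" by simp
    have neg: "\<langle>z\<rangle> powr s = 1 / \<langle>z\<rangle> powr \<bar>s\<bar>" for z :: "real ^ 'a"
      by (subst s, rule powr_minus_divide)
    have pos: "\<langle>z\<rangle> powr \<bar>s\<bar> > 0" for z :: "real ^ 'a"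
      using jbracket_pos[of z] by simp
    \<comment> \<open>Write \<open>x\<close> as \<open>(x + y) + (- y)\<close>; the bracket is even.
      Dividing by the positive powers of the brackets of \<open>x\<close> and \<open>x + y\<close>
      then gives the claim.\<close>
    have "\<langle>x\<rangle> powr \<bar>s\<bar> \<le> (2 / sqrt 3) powr \<bar>s\<bar> * \<langle>x + y\<rangle> powr \<bar>s\<bar> * \<langle>y\<rangle> powr \<bar>s\<bar>"
      using powr_le[of "x + y" "- y"] by (simp add: jbracket_minus)
    then show ?thesis
      unfolding neg using pos[of x] pos[of "x + y"] by (simp add: field_simps)
  qed
qed

lemma jbracket_add_extremal:
  obtains u :: "real ^ 'd" where "\<langle>u + u\<rangle> = 2 / sqrt 3 * \<langle>u\<rangle> * \<langle>u\<rangle>"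
proof -
  \<comment> \<open>Both squares in the defect vanish when \<open>a = b\<close> and
    \<open>2 * a * b = 1\<close>, which forces the length \<open>1 / sqrt 2\<close>. The direction
    is arbitrary; some coordinate exists since index types are nonempty.\<close>
  define u :: "real ^ 'd" where "u = axis undefined (1 / sqrt 2)"
  have norm_u: "norm u = 1 / sqrt 2"
    by (simp add: u_def norm_eq_sqrt_inner inner_axis_axis real_sqrt_divide)
  have "u + u = 2 *\<^sub>R u"
    by (simp add: scaleR_2)
  then have "norm (u + u) = 2 * (1 / sqrt 2)"
    by (simp add: norm_u)
  then have "\<langle>u + u\<rangle> = sqrt 3"
    by (simp add: jbracket_def power_divide power_mult_distrib)
  moreover have "\<langle>u\<rangle> * \<langle>u\<rangle> = 3 / 2"
    by (simp add: jbracket_def norm_u power_divide)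
  moreover have "sqrt 3 = 2 / sqrt 3 * (3 / 2)"
    by (simp add: real_div_sqrt)
  ultimately have "\<langle>u + u\<rangle> = 2 / sqrt 3 * \<langle>u\<rangle> * \<langle>u\<rangle>"
    by (simp only: mult.assoc)
  then show ?thesis by (rule that)
qed

text \<open>It suffices to test the hypothesis at one pair where the inequality is an equality and
  to cancel positive factors; no sign of \<open>C\<close> has to be known.\<close>

lemma jbracket_add_powr_optimal:
  assumes C: "\<And>x y :: real ^ 'd. \<langle>x + y\<rangle> powr s \<le> C * \<langle>x\<rangle> powr s * \<langle>y\<rangle> powr \<bar>s\<bar>"
  shows "(2 / sqrt 3) powr \<bar>s\<bar> \<le> C"
proof -
  obtain u :: "real ^ 'd" where u: "\<langle>u + u\<rangle> = 2 / sqrt 3 * \<langle>u\<rangle> * \<langle>u\<rangle>"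
    by (rule jbracket_add_extremal)
  define p where "p = \<langle>u\<rangle> powr \<bar>s\<bar>"
  define k where "k = (2 / sqrt 3) powr \<bar>s\<bar>"
  have pos: "p > 0" "k > 0"
    using jbracket_pos[of u] by (simp_all add: p_def k_def)
  have dbl: "\<langle>u + u\<rangle> powr \<bar>s\<bar> = k * p * p"
    unfolding u by (simp add: p_def k_def powr_mult jbracket_pos less_imp_le
          del: times_divide_eq_left times_divide_eq_right)
  have "k \<le> C"
  proof (cases "s \<ge> 0")
    case True
    then have "k * (p * p) \<le> C * (p * p)"
      using C[of u u] dbl by (simp add: p_def mult.assoc)
    then show ?thesis using pos by simp
  next
    case False
    then have s: "s = - \<bar>s\<bar>" by simp
    have neg: "\<langle>z\<rangle> powr s = 1 / \<langle>z\<rangle> powr \<bar>s\<bar>" for z :: "real ^ 'd"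
      by (subst s, rule powr_minus_divide)
    \<comment> \<open>The extremal pair is now \<open>u + u\<close> and \<open>- u\<close>, with sum
      \<open>u\<close>. In terms of \<open>p\<close> and \<open>k\<close> the bound reads
      \<open>1 / p \<le> C / (k * p)\<close>, that is \<open>k \<le> C\<close>.\<close>
    have "\<langle>u\<rangle> powr s \<le> C * \<langle>u + u\<rangle> powr s * \<langle>u\<rangle> powr \<bar>s\<bar>"
      using C[of "u + u" "- u"] by (simp only: add.assoc add.right_inverse add_0_right jbracket_minus)
    then have "1 / p \<le> C * (1 / (k * p * p)) * p"
      unfolding neg dbl p_def .
    then show ?thesis using pos by (simp add: field_simps)
  qed
  then show ?thesis by (simp add: k_def)
qed

theorem lemma2p1:
  fixes s :: real
  shows "(\<forall>(x :: real ^ 'd) (y :: real ^ 'd).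
            \<langle>x + y\<rangle> powr s \<le> (2 / sqrt 3) powr \<bar>s\<bar> * \<langle>x\<rangle> powr s * \<langle>y\<rangle> powr \<bar>s\<bar>)
       \<and> (\<forall>C :: real.
            (\<forall>(x :: real ^ 'd) (y :: real ^ 'd).
               \<langle>x + y\<rangle> powr s \<le> C * \<langle>x\<rangle> powr s * \<langle>y\<rangle> powr \<bar>s\<bar>)
            \<longrightarrow> (2 / sqrt 3) powr \<bar>s\<bar> \<le> C)"
  by (blast intro: jbracket_add_powr_le jbracket_add_powr_optimal)

end
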